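(* Let $X$ be a real Banach space with norm $\|\cdot\|_X$, and let $F_k:X\to\mathcal{I}$ be $\preccurlyeq_{CW}$-lsc for $k=1,\dots,m$. Let $\varepsilon=(\varepsilon_1,\dots,\varepsilon_m)\in\mathbb{R}^m_+\setminus\{0\}$ and let $x_0\in X$ satisfy $\sum_{k=1}^{m}F_k(u)+[0,\sum_{k=1}^{m}\varepsilon_k]\not\prec_{CW}\sum_{k=1}^{m}F_k(x_0)$ for all $u\in X$. Then there is a point $\overline{u}\in X$ such that (a) $\sum_{k=1}^{m}F_k(u)+[0,\sum_{k=1}^{m}\varepsilon_k]\not\prec_{CW}\sum_{k=1}^{m}F_k(\overline{u})$ for all $u\in X$; (b) $\|x_0-\overline{u}\|_X\leq\dfrac{\sum_{k=1}^{m}\varepsilon_k}{\sum_{k=1}^{m}\sqrt{\varepsilon_k}}$; (c) $\sum_{k=1}^{m}F_k(u)+\big[0,\ \sum_{k=1}^{m}\sqrt{\varepsilon_k}\,\|u-\overline{u}\|_X\big]\not\prec_{CW}\sum_{k=1}^{m}F_k(\overline{u})$ for all $u\in X$.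
   Context: $\mathcal{I}$ is the set of all compact intervals $[\underline q,\overline q]$ with $\underline q\le\overline q$ real. For $Q=[\underline q,\overline q]\in\mathcal I$ put $q^c=\frac{\underline q+\overline q}{2}$ and $q^w=\frac{\overline q-\underline q}{2}$. Addition: $[\underline q,\overline q]+[\underline r,\overline r]=[\underline q+\underline r,\overline q+\overline r]$. Order: $Q\prec_{CW}R$ iff $q^c<r^c$ and $q^w<r^w$. $\mathbb{R}^m_+$ is the nonnegative orthant of $\mathbb{R}^m$. For an interval-valued function $f=[\underline f,\overline f]$ on $X$ write $f^c=\frac{\underline f+\overline f}{2}$, $f^w=\frac{\overline f-\underline f}{2}$; $f$ is $\preccurlyeq_{CW}$-lsc if the real-valued functions $f^c$ and $f^w$ are both lower semicontinuous on $X$. *)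

theory Defs
  imports "HOL-Analysis.Analysis" "HOL-Library.Interval"
begin

text \<open>
  Compact real intervals are the elements of \<^typ>\<open>real interval\<close>, with endpoints
  \<^const>\<open>lower\<close>, \<^const>\<open>upper\<close> and endpointwise addition.  The interval with endpoints
  \<open>a \<le> b\<close> is \<open>Interval (a, b)\<close>; as \<open>Interval\<close> is the abstraction function of a typedef,
  its value is unspecified when \<open>a > b\<close>.  The order \<open><\<close> that the library puts on intervals is
  strict inclusion and is not the order \<open>\<prec>\<^sub>C\<^sub>W\<close> below.
\<close>

definition icenter :: "real interval \<Rightarrow> real" where
  "icenter Q = (lower Q + upper Q) / 2"

text \<open>Half of the library's \<^const>\<open>width\<close>.\<close>

definition ihalfwidth :: "real interval \<Rightarrow> real" where
  "ihalfwidth Q = (upper Q - lower Q) / 2"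

definition cw_less :: "real interval \<Rightarrow> real interval \<Rightarrow> bool" (infix "\<prec>\<^sub>C\<^sub>W" 50) where
  "Q \<prec>\<^sub>C\<^sub>W R \<longleftrightarrow> icenter Q < icenter R \<and> ihalfwidth Q < ihalfwidth R"

definition lsc :: "('a::topological_space \<Rightarrow> real) \<Rightarrow> bool" where
  "lsc f \<longleftrightarrow> (\<forall>x. \<forall>y < f x. \<forall>\<^sub>F u in nhds x. y < f u)"

definition cw_lsc :: "('a::topological_space \<Rightarrow> real interval) \<Rightarrow> bool" where
  "cw_lsc F \<longleftrightarrow> lsc (\<lambda>x. icenter (F x)) \<and> lsc (\<lambda>x. ihalfwidth (F x))"

definition nonneg_orthant :: "(real ^ 'm) set" where
  "nonneg_orthant = {v. \<forall>k. 0 \<le> v $ k}"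

end

theory Submission
  imports Defs
begin

text \<open>
  Put \<open>c\<close> and \<open>w\<close> for the centre and half-width of \<open>\<Sum>k. F k\<close>, and
  \<open>g u = max (c u - c x\<^sub>0) (w u - w x\<^sub>0)\<close>.  Both the centre and the half-width of
  \<open>[0, d]\<close> equal \<open>d / 2\<close>, so \<open>g z \<le> g u + d / 2\<close> prevents
  \<open>(\<Sum>k. F k u) + [0, d] \<prec>\<^sub>C\<^sub>W (\<Sum>k. F k z)\<close>.  The hypothesis on \<open>x\<^sub>0\<close> says \<open>g \<ge> - (\<Sum>k. \<epsilon> k) / 2\<close>
  while \<open>g x\<^sub>0 = 0\<close>, and Ekeland's variational principle for \<open>g\<close> with slope
  \<open>(\<Sum>k. sqrt (\<epsilon> k)) / 2\<close> yields the required point.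
\<close>

lemma lsc_add:
  assumes "lsc f" "lsc g"
  shows "lsc (\<lambda>x. f x + g x)"
  unfolding lsc_def
proof (intro allI impI)
  fix x y assume y: "y < f x + g x"
  define d where "d = (f x + g x - y) / 2"
  have "d > 0" using y by (simp add: d_def)
  then have "\<forall>\<^sub>F u in nhds x. f x - d < f u" "\<forall>\<^sub>F u in nhds x. g x - d < g u"
    using assms by (auto simp: lsc_def)
  then show "\<forall>\<^sub>F u in nhds x. y < f u + g u"
    by eventually_elim (auto simp: d_def field_simps)
qed

lemma lsc_max:
  assumes "lsc f" "lsc g"
  shows "lsc (\<lambda>x. max (f x) (g x))"
  unfolding lsc_def less_max_iff_disj
proof (intro allI impI)
  fix x y assume "y < f x \<or> y < g x"
  then have "(\<forall>\<^sub>F u in nhds x. y < f u) \<or> (\<forall>\<^sub>F u in nhds x. y < g u)"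
    using assms by (auto simp: lsc_def)
  then show "\<forall>\<^sub>F u in nhds x. y < f u \<or> y < g u"
    by (elim disjE) (erule eventually_mono, simp)+
qed

lemma continuous_imp_lsc:
  assumes "continuous_on UNIV f"
  shows "lsc f"
  unfolding lsc_def
proof (intro allI impI)
  fix x y assume "y < f x"
  have "open {u. y < f u}"
    using assms by (intro open_Collect_less) auto
  with \<open>y < f x\<close> show "\<forall>\<^sub>F u in nhds x. y < f u"
    by (auto simp: eventually_nhds)
qed

lemma lsc_sum: "(\<And>k. k \<in> A \<Longrightarrow> lsc (f k)) \<Longrightarrow> lsc (\<lambda>x. \<Sum>k\<in>A. f k x)"
  by (induction A rule: infinite_finite_induct) (simp_all add: lsc_add continuous_imp_lsc)

lemma closed_sublevel_lsc:
  assumes "lsc f"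
  shows "closed {x. f x \<le> a}"
proof -
  have "open {x. a < f x}"
    using assms by (subst open_subopen) (simp add: lsc_def eventually_nhds subset_eq)
  moreover have "- {x. f x \<le> a} = {x. a < f x}" by auto
  ultimately show ?thesis by (simp add: closed_def)
qed

text \<open>
  The sets \<open>T z\<close> are closed and \<open>u \<in> T z\<close> is a preorder; greedily minimising \<open>g\<close> along it
  makes the diameters of the nested sets \<open>T (s n)\<close> shrink to \<open>0\<close>, so their common point is minimal.
\<close>

lemma ekeland:
  fixes g :: "'a::complete_space \<Rightarrow> real"
  assumes lsc: "lsc g" and bdd: "bdd_below (range g)" and "0 < k"
  obtains v where "g v + k * dist x v \<le> g x" "\<And>u. u \<noteq> v \<Longrightarrow> g v < g u + k * dist v u"
proof -
  define T where "T z = {u. g u + k * dist z u \<le> g z}" for z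
  have refl: "z \<in> T z" for z
    by (simp add: T_def)
  have trans: "T u \<subseteq> T z" if "u \<in> T z" for u z
  proof
    fix t assume "t \<in> T u"
    moreover have "k * dist z t \<le> k * dist z u + k * dist u t"
      using \<open>0 < k\<close> dist_triangle[of z t u] by (simp flip: distrib_left)
    ultimately show "t \<in> T z" using that by (simp add: T_def)
  qed
  have closed: "closed (T z)" for z
    unfolding T_def
    by (intro closed_sublevel_lsc lsc_add lsc continuous_imp_lsc continuous_intros)
  have bddT: "bdd_below (g ` T z)" for z
    using bdd by (rule bdd_below_mono) auto
  have "\<exists>u \<in> T z. g u < Inf (g ` T z) + (1/2)^n" for z and n :: nat
    using cInf_less_iff[OF _ bddT, of z "Inf (g ` T z) + (1/2)^n"] refl[of z] by auto
  then have "\<forall>n z. \<exists>u. u \<in> T z \<and> g u < Inf (g ` T z) + (1/2)^n"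
    by blast
  then obtain next_pt where nxt: "next_pt n z \<in> T z"
    "g (next_pt n z) < Inf (g ` T z) + (1/2)^n" for z n
    unfolding choice_iff by blast
  define s where "s = rec_nat x next_pt"
  have s0: "s 0 = x" and sSuc: "s (Suc n) = next_pt n (s n)" for n
    by (simp_all add: s_def)
  have dec: "decseq (\<lambda>n. T (s n))"
    by (intro decseq_SucI) (simp add: sSuc trans nxt)
  \<comment> \<open>\<open>y\<close> also lies in \<open>T (s n)\<close>, so \<open>g y\<close> is
    at least the infimum there, which \<open>g (s (Suc n))\<close> exceeds by less than
    \<open>(1/2)^n\<close>. The drop of \<open>g\<close> from \<open>s (Suc n)\<close> to
    \<open>y\<close> bounds \<open>k * dist (s (Suc n)) y\<close>.\<close>
  have near: "k * dist (s (Suc n)) y < (1/2)^n" if "y \<in> T (s (Suc n))" for n y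
  proof -
    have "y \<in> T (s n)" using that dec by (auto simp: decseq_Suc_iff)
    then have "Inf (g ` T (s n)) \<le> g y" by (intro cInf_lower bddT) auto
    with nxt(2)[of n "s n"] that show ?thesis by (simp add: sSuc T_def)
  qed
  have small: "\<exists>n. \<forall>y\<in>T (s n). \<forall>z\<in>T (s n). dist y z < e" if "e > 0" for e
  proof -
    \<comment> \<open>Half of \<open>k * e\<close>, because \<open>y\<close> and \<open>z\<close>
      are compared through \<open>s (Suc n)\<close> and each contributes one
      \<open>(1/2)^n\<close>.\<close>
    obtain n where n: "(1/2)^n < k * e / 2"
      using real_arch_pow_inv[of "k * e / 2" "1/2"] mult_pos_pos[OF \<open>0 < k\<close> \<open>e > 0\<close>] by auto
    have "dist y z < e" if "y \<in> T (s (Suc n))" "z \<in> T (s (Suc n))" for y z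
    proof -
      have "k * dist y z \<le> k * (dist (s (Suc n)) y + dist (s (Suc n)) z)"
        using \<open>0 < k\<close> dist_triangle3[of y z "s (Suc n)"] by simp
      also have "\<dots> < k * e"
        using near[OF that(1)] near[OF that(2)] n by (simp add: distrib_left)
      finally show ?thesis using \<open>0 < k\<close> by simp
    qed
    then show ?thesis by blast
  qed
  \<comment> \<open>Cantor's intersection theorem; completeness of the space enters here.\<close>
  have "\<exists>v. (\<Inter>n. T (s n)) = {v}"
  proof (rule decreasing_closed_nest_sing)
    show "T (s n) \<noteq> {}" for n using refl by blast
  qed (use closed monotoneD[OF dec] small in simp_all)
  then obtain v where v: "(\<Inter>n. T (s n)) = {v}" ..
  then have vT: "v \<in> T (s n)" for n by auto
  show thesis
  proof
    show "g v + k * dist x v \<le> g x"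
      using vT[of 0] by (simp add: s0 T_def)
    fix u assume "u \<noteq> v"
    have "u \<notin> T v"
    proof
      assume "u \<in> T v"
      then have "u \<in> (\<Inter>n. T (s n))" using trans[OF vT] by blast
      with v \<open>u \<noteq> v\<close> show False by simp
    qed
    then show "g v < g u + k * dist v u" by (simp add: T_def)
  qed
qed

lemma icenter_add: "icenter (Q + R) = icenter Q + icenter R"
  by (simp add: icenter_def field_simps)

lemma ihalfwidth_add: "ihalfwidth (Q + R) = ihalfwidth Q + ihalfwidth R"
  by (simp add: ihalfwidth_def field_simps)

lemma icenter_sum: "icenter (\<Sum>k\<in>A. F k) = (\<Sum>k\<in>A. icenter (F k))"
  by (induction A rule: infinite_finite_induct) (simp_all add: icenter_add, simp_all add: icenter_def)

lemma ihalfwidth_sum: "ihalfwidth (\<Sum>k\<in>A. F k) = (\<Sum>k\<in>A. ihalfwidth (F k))"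
  by (induction A rule: infinite_finite_induct) (simp_all add: ihalfwidth_add, simp_all add: ihalfwidth_def)

text \<open>The sign of \<open>d\<close> makes \<open>Interval (0, d)\<close> a genuine interval, so
  that its endpoints can be computed.\<close>

lemma add_Interval_cw_less_iff:
  assumes "0 \<le> d"
  shows "Q + Interval (0, d) \<prec>\<^sub>C\<^sub>W R \<longleftrightarrow>
    icenter Q + d / 2 < icenter R \<and> ihalfwidth Q + d / 2 < ihalfwidth R"
  using assms
  by (simp add: cw_less_def icenter_add ihalfwidth_add)
    (simp add: icenter_def ihalfwidth_def lower_def upper_def Interval_inverse)

theorem proposition3p1:
  fixes F :: "'m::finite \<Rightarrow> 'x::banach \<Rightarrow> real interval"
    and \<epsilon> :: "real ^ 'm"
    and x\<^sub>0 :: 'x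
  assumes "\<And>k. cw_lsc (F k)"
    and "\<epsilon> \<in> nonneg_orthant - {0}"
    and "\<And>u. \<not> (\<Sum>k\<in>UNIV. F k u) + Interval (0, \<Sum>k\<in>UNIV. \<epsilon> $ k) \<prec>\<^sub>C\<^sub>W (\<Sum>k\<in>UNIV. F k x\<^sub>0)"
  shows "\<exists>u'.
      (\<forall>u. \<not> (\<Sum>k\<in>UNIV. F k u) + Interval (0, \<Sum>k\<in>UNIV. \<epsilon> $ k) \<prec>\<^sub>C\<^sub>W (\<Sum>k\<in>UNIV. F k u'))
    \<and> norm (x\<^sub>0 - u') \<le> (\<Sum>k\<in>UNIV. \<epsilon> $ k) / (\<Sum>k\<in>UNIV. sqrt (\<epsilon> $ k))
    \<and> (\<forall>u. \<not> (\<Sum>k\<in>UNIV. F k u) + Interval (0, (\<Sum>k\<in>UNIV. sqrt (\<epsilon> $ k)) * norm (u - u'))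
             \<prec>\<^sub>C\<^sub>W (\<Sum>k\<in>UNIV. F k u'))"
proof -
  define E where "E = (\<Sum>k\<in>UNIV. \<epsilon> $ k)"
  define S where "S = (\<Sum>k\<in>UNIV. sqrt (\<epsilon> $ k))"
  have nn: "0 \<le> \<epsilon> $ k" for k
    using assms(2) by (simp add: nonneg_orthant_def)
  \<comment> \<open>A nonzero vector with nonnegative entries has a positive one, which makes both
    the error \<open>E\<close> and the slope and divisor \<open>S\<close> positive.\<close>
  obtain j where j: "\<epsilon> $ j > 0"
    using assms(2) nn by (auto simp: vec_eq_iff less_le)
  have "E > 0" unfolding E_def using nn j by (intro sum_pos2[of _ j]) auto
  have "S > 0" unfolding S_def using nn j by (intro sum_pos2[of _ j]) auto
  define c where "c u = icenter (\<Sum>k\<in>UNIV. F k u)" for u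
  define w where "w u = ihalfwidth (\<Sum>k\<in>UNIV. F k u)" for u
  have cw_iff: "(\<Sum>k\<in>UNIV. F k u) + Interval (0, d) \<prec>\<^sub>C\<^sub>W (\<Sum>k\<in>UNIV. F k z) \<longleftrightarrow>
      c u + d / 2 < c z \<and> w u + d / 2 < w z" if "0 \<le> d" for d u z
    using add_Interval_cw_less_iff[OF that] by (simp add: c_def w_def)
  define g where "g u = max (c u - c x\<^sub>0) (w u - w x\<^sub>0)" for u
  have not_cw: "\<not> (\<Sum>k\<in>UNIV. F k u) + Interval (0, d) \<prec>\<^sub>C\<^sub>W (\<Sum>k\<in>UNIV. F k z)"
    if "0 \<le> d" "g z \<le> g u + d / 2" for d u z
    using that by (auto simp: cw_iff g_def)
  have "lsc c" "lsc w"
    unfolding c_def w_def icenter_sum ihalfwidth_sum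
    using assms(1) by (auto intro!: lsc_sum simp: cw_lsc_def)
  then have "lsc g"
    unfolding g_def diff_conv_add_uminus
    by (intro lsc_max lsc_add[OF _ continuous_imp_lsc] continuous_intros)
  \<comment> \<open>Failure of the order at \<open>x\<^sub>0\<close> means that the centre or the
    half-width drops by at most \<open>E / 2\<close>; the maximum \<open>g\<close> inherits the
    bound from that one.\<close>
  have g_lower: "- E / 2 \<le> g u" for u
    using assms(3)[of u] \<open>E > 0\<close> unfolding E_def[symmetric] by (auto simp: cw_iff g_def)
  then have "bdd_below (range g)" by (rule bdd_belowI2)
  with \<open>lsc g\<close> \<open>S > 0\<close> obtain v where
    v: "g v + S / 2 * dist x\<^sub>0 v \<le> g x\<^sub>0" "\<And>u. u \<noteq> v \<Longrightarrow> g v < g u + S / 2 * dist v u"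
    using ekeland[of g "S / 2" x\<^sub>0] by auto
  have "g x\<^sub>0 = 0" by (simp add: g_def)
  have "0 \<le> S * dist x\<^sub>0 v" using \<open>S > 0\<close> by simp
  then have "g v \<le> 0" using v(1) \<open>g x\<^sub>0 = 0\<close> by simp
  show ?thesis
    unfolding E_def[symmetric] S_def[symmetric]
  proof (intro exI[of _ v] conjI allI)
    fix u
    show "\<not> (\<Sum>k\<in>UNIV. F k u) + Interval (0, E) \<prec>\<^sub>C\<^sub>W (\<Sum>k\<in>UNIV. F k v)"
      using \<open>g v \<le> 0\<close> g_lower[of u] \<open>E > 0\<close> by (intro not_cw) auto
    \<comment> \<open>The Ekeland inequality excludes \<open>u = v\<close>, where the claim is
      trivial. The slope \<open>S / 2\<close> turns into the radius of
      \<open>[0, S * norm (u - v)]\<close>.\<close>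
    have "g v \<le> g u + S * norm (u - v) / 2"
      using v(2)[of u] by (cases "u = v") (auto simp: dist_norm norm_minus_commute)
    then show "\<not> (\<Sum>k\<in>UNIV. F k u) + Interval (0, S * norm (u - v)) \<prec>\<^sub>C\<^sub>W (\<Sum>k\<in>UNIV. F k v)"
      using \<open>S > 0\<close> by (intro not_cw) auto
  next
    \<comment> \<open>The slope term is at most the total drop
      \<open>g x\<^sub>0 - g v = - g v\<close>, which is at most \<open>E / 2\<close>.\<close>
    have "S * dist x\<^sub>0 v \<le> E"
      using v(1) \<open>g x\<^sub>0 = 0\<close> g_lower[of v] by simp
    then show "norm (x\<^sub>0 - v) \<le> E / S"
      using \<open>S > 0\<close> by (simp add: dist_norm field_simps)
  qed
qed

end
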